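(* Let $S$ be a semigroup generated by its squares, let $\sigma:S\to S$ be an involutive automorphism, and let $\mu:S\to\mathbb{C}$ be a multiplicative function such that $\mu(x\sigma(x))=1$ for all $x\in S$. The solutions $f,g:S\to\mathbb{C}$ of the functional equation $$f(xy)+\mu(y)f(\sigma(y)x)=2f(y)g(x)\quad\text{for all } x,y\in S$$ are exactly the following pairs: (1) $f=0$ and $g$ is arbitrary. (2) $f=\alpha\,\dfrac{\chi+\chi^{*}}{2}$ and $g=\dfrac{\chi+\chi^{*}}{2}$, where $\alpha\in\mathbb{C}\setminus\{0\}$ is a constant and $\chi:S\to\mathbb{C}$ is a multiplicative function. That is, every solution is of one of the forms (1)-(2), and conversely every pair of one of these forms is a solution.
   Context: A semigroup is a set with an associative composition (no identity element is assumed). $S$ is generated by its squares if every element of $S$ is a finite product of elements of the form $x^2=xx$, $x\in S$. An involutive automorphism is a semigroup automorphism $\sigma:S\to S$ (so $\sigma(xy)=\sigma(x)\sigma(y)$) with $\sigma(\sigma(x))=x$ for all $x\in S$. A function $\chi:S\to\mathbb{C}$ is multiplicative if $\chi(xy)=\chi(x)\chi(y)$ for all $x,y\in S$. For $F:S\to\mathbb{C}$, the function $F^{*}:S\to\mathbb{C}$ is defined by $F^{*}(x)=\mu(x)F(\sigma(x))$. *)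

theory Defs
  imports Complex_Main
begin

text \<open>Semigroups are types of class \<^class>\<open>semigroup_mult\<close>. There is no identity element,
  so a finite product of squares has at least one factor; by associativity it can be
  bracketed to the left.\<close>

definition generated_by_squares :: "'a::semigroup_mult itself \<Rightarrow> bool" where
  "generated_by_squares _ \<longleftrightarrow>
     (\<forall>s::'a. \<exists>x xs. s = foldl (\<lambda>p y. p * (y * y)) (x * x) xs)"

text \<open>Bijectivity is implied by \<open>\<sigma> (\<sigma> x) = x\<close>.\<close>

definition involutive_automorphism :: "('a::semigroup_mult \<Rightarrow> 'a) \<Rightarrow> bool" where
  "involutive_automorphism \<sigma> \<longleftrightarrow>
     (\<forall>x y. \<sigma> (x * y) = \<sigma> x * \<sigma> y) \<and> (\<forall>x. \<sigma> (\<sigma> x) = x)"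

text \<open>The zero function counts as multiplicative.\<close>

definition multiplicative :: "('a::semigroup_mult \<Rightarrow> complex) \<Rightarrow> bool" where
  "multiplicative \<chi> \<longleftrightarrow> (\<forall>x y. \<chi> (x * y) = \<chi> x * \<chi> y)"

definition star ::
    "('a \<Rightarrow> complex) \<Rightarrow> ('a \<Rightarrow> 'a) \<Rightarrow> ('a \<Rightarrow> complex) \<Rightarrow> 'a \<Rightarrow> complex" where
  "star \<mu> \<sigma> F x = \<mu> x * F (\<sigma> x)"

end

theory Submission
  imports Defs
begin

text \<open>Split \<open>f\<close> and \<open>g\<close> into even and odd parts under \<open>F \<mapsto> F\<^sup>*\<close>. Comparing the equation at
  \<open>(x, y)\<close> and \<open>(\<sigma> y, x)\<close> shows that the even parts are proportional and that one of the odd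
  parts vanishes; an odd part of \<open>f\<close> would change sign under cyclic shifts, so it vanishes on
  all triple products, hence everywhere. The same argument excludes \<open>g = 0 \<noteq> f\<close>. Thus \<open>f\<close> is a
  multiple of \<open>g\<close>, and \<open>g\<close> solves \<open>g (x y) + \<mu> y g (\<sigma> y x) = 2 g x g y\<close>. For such \<open>g\<close> the
  function \<open>g (x y) - g x g y\<close> obeys the sine addition law in \<open>x\<close>, so it has the form
  \<open>t x t y\<close>, and \<open>\<chi> = g + t\<close> is multiplicative with \<open>\<chi>\<^sup>* = g - t\<close>.\<close>

section \<open>Factorizations and addition laws\<close>

text \<open>A product of squares has at least two factors, so every element is a product of two
  elements; splitting one factor again gives three.\<close>

lemma generated_by_squares_product3:
  fixes s :: "'a::semigroup_mult"
  assumes "generated_by_squares TYPE('a)"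
  obtains x y z where "s = x * y * z"
proof -
  have prod2: "\<exists>a b. t = a * b" for t :: 'a
  proof -
    obtain x xs where t: "t = foldl (\<lambda>p y. p * (y * y)) (x * x) xs"
      using assms unfolding generated_by_squares_def by blast
    show ?thesis by (cases xs rule: rev_cases) (auto simp: t)
  qed
  show ?thesis using that prod2 by metis
qed

lemma symmetrized_product_zero_cases:
  fixes u v :: "'a \<Rightarrow> complex"
  assumes "\<And>x y. u x * v y + u y * v x = 0"
  shows "(\<forall>x. u x = 0) \<or> (\<forall>x. v x = 0)"
proof (rule disjCI)
  assume "\<not> (\<forall>x. v x = 0)"
  then obtain a where a: "v a \<noteq> 0" by blast
  with assms[of a a] have "u a = 0" by simp
  with a assms[of _ a] show "\<forall>x. u x = 0" by simp
qed

text \<open>For fixed \<open>z\<close> the map \<open>A _ z\<close> obeys a sine addition law.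
  Associativity then makes \<open>A\<close> a constant times \<open>s x * s y\<close> for one
  section \<open>s\<close> of \<open>A\<close>, and a square root of the constant turns
  \<open>s\<close> into \<open>t\<close>.\<close>

lemma cosine_addition_from_sine_addition:
  fixes g :: "'a::semigroup_mult \<Rightarrow> complex"
  defines "A \<equiv> \<lambda>x y. g (x * y) - g x * g y"
  assumes sine: "\<And>x y z. A (x * y) z = A x z * g y + g x * A y z"
  obtains t where "\<And>x y. g (x * y) = g x * g y + t x * t y"
    and "\<And>x y. t (x * y) = t x * g y + g x * t y"
proof (cases "\<forall>x y. A x y = 0")
  case True
  then show ?thesis using that[of "\<lambda>x. 0"] by (simp add: A_def)
next
  case False
  then obtain b c where bc: "A b c \<noteq> 0" by blast
  define s where "s = (\<lambda>x. A x c)"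
  have s: "s (x * y) = s x * g y + g x * s y" for x y
    by (simp add: s_def sine)
  have sb: "s b \<noteq> 0" using bc by (simp add: s_def)
  have As: "A x y * s z = s x * A y z" for x y z
  proof -
    \<comment> \<open>Both sides expand \<open>s (x * y * z)\<close>, bracketed to the left and to
      the right.\<close>
    have "s (x * y) * g z + g (x * y) * s z = s x * g (y * z) + g x * s (y * z)"
      by (simp flip: s add: mult.assoc)
    then show ?thesis by (simp add: s A_def algebra_simps)
  qed
  define k where "k = csqrt (A b b / (s b)\<^sup>2)"
  have A: "A x y = (k * s x) * (k * s y)" for x y
  proof -
    have "A x y * (s b)\<^sup>2 = s x * (A y b * s b)"
      using As[of x y b] by (simp add: power2_eq_square)
    also have "\<dots> = s x * (s y * A b b)" using As[of y b b] by simp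
    finally have "A x y = A b b / (s b)\<^sup>2 * s x * s y"
      using sb by (simp add: field_simps)
    also have "A b b / (s b)\<^sup>2 = k * k"
      by (simp add: k_def flip: power2_eq_square)
    finally show ?thesis by (simp add: algebra_simps)
  qed
  show ?thesis
  proof (rule that[of "\<lambda>x. k * s x"])
    show "g (x * y) = g x * g y + k * s x * (k * s y)" for x y
      using A[of x y] by (simp add: A_def algebra_simps)
    show "k * s (x * y) = k * s x * g y + g x * (k * s y)" for x y
      by (simp add: s algebra_simps)
  qed
qed

section \<open>The equation with \<open>f = g\<close>\<close>

locale twisted_involution =
  fixes \<sigma> :: "'a::semigroup_mult \<Rightarrow> 'a" and \<mu> :: "'a \<Rightarrow> complex"
  assumes involutive: "involutive_automorphism \<sigma>"
    and multiplicative_mu: "multiplicative \<mu>"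
    and mu_sigma: "\<And>x. \<mu> (x * \<sigma> x) = 1"
begin

lemma sigma_mult [simp]: "\<sigma> (x * y) = \<sigma> x * \<sigma> y"
  and sigma_sigma [simp]: "\<sigma> (\<sigma> x) = x"
  using involutive by (auto simp: involutive_automorphism_def)

lemma mu_mult [simp]: "\<mu> (x * y) = \<mu> x * \<mu> y"
  using multiplicative_mu by (simp add: multiplicative_def)

lemma mu_mu_sigma [simp]: "\<mu> x * \<mu> (\<sigma> x) = 1"
  using mu_sigma[of x] by simp

lemma mu_mu_sigma_cancel [simp]: "\<mu> x * (\<mu> (\<sigma> x) * c) = c"
  by (simp flip: mult.assoc)

text \<open>Since \<open>\<mu> x * \<mu> (\<sigma> x) = 1\<close>, \<open>st\<close> is an
  involution on functions, which gives even and odd parts.\<close>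

abbreviation st :: "('a \<Rightarrow> complex) \<Rightarrow> 'a \<Rightarrow> complex" where
  "st \<equiv> star \<mu> \<sigma>"

text \<open>The two terms on the left supply the pure and the mixed products of
  \<open>\<chi>\<close> and \<open>st \<chi>\<close>, which together form the product of the
  sums.\<close>

lemma mean_star_solves:
  assumes "multiplicative \<chi>"
  defines "g \<equiv> \<lambda>x. (\<chi> x + st \<chi> x) / 2"
  shows "g (x * y) + \<mu> y * g (\<sigma> y * x) = 2 * g y * g x"
  using assms(1) by (simp add: g_def star_def multiplicative_def field_simps)

lemma dalembert_variant_solution:
  assumes eq: "\<And>x y. g (x * y) + \<mu> y * g (\<sigma> y * x) = 2 * g y * g x"
    and even: "st g = g"
  obtains \<chi> where "multiplicative \<chi>" and "g = (\<lambda>x. (\<chi> x + st \<chi> x) / 2)"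
proof -
  \<comment> \<open>The equation at \<open>(x * y, z)\<close>, minus \<open>\<mu> z\<close> times
    that at \<open>(\<sigma> z * x, y)\<close>, plus that at \<open>(x, y * z)\<close>: the twisted
    triple products cancel.\<close>
  have triple: "g (x * y * z) = g (x * y) * g z + g (x * z) * g y + g (y * z) * g x
      - 2 * g x * g y * g z" for x y z
  proof -
    have "g (x * y * z) + \<mu> z * g (\<sigma> z * x * y) = 2 * g z * g (x * y)"
      using eq[of "x * y" z] by (simp add: mult.assoc)
    moreover have "\<mu> z * g (\<sigma> z * x * y) + \<mu> z * (\<mu> y * g (\<sigma> y * \<sigma> z * x))
        = \<mu> z * (2 * g y * g (\<sigma> z * x))"
      using eq[of "\<sigma> z * x" y] by (simp add: mult.assoc flip: distrib_left)
    moreover have "g (x * y * z) + \<mu> z * (\<mu> y * g (\<sigma> y * \<sigma> z * x)) = 2 * g (y * z) * g x"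
      using eq[of x "y * z"] by (simp add: mult.assoc mult.left_commute)
    moreover have "\<mu> z * g (\<sigma> z * x) = 2 * g z * g x - g (x * z)"
      using eq[of x z] by (simp add: algebra_simps)
    then have "\<mu> z * (2 * g y * g (\<sigma> z * x)) = 2 * g y * (2 * g z * g x - g (x * z))"
      by (simp add: mult.left_commute)
    ultimately have "2 * g (x * y * z) =
        2 * g z * g (x * y) - 2 * g y * (2 * g z * g x - g (x * z)) + 2 * g (y * z) * g x"
      by algebra
    then show ?thesis by algebra
  qed
  obtain t where g: "\<And>x y. g (x * y) = g x * g y + t x * t y"
    and t: "\<And>x y. t (x * y) = t x * g y + g x * t y"
  proof -
    have "g (x * y * z) - g (x * y) * g z =
        (g (x * z) - g x * g z) * g y + g x * (g (y * z) - g y * g z)" for x y z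
      using triple[of x y z] by algebra
    from cosine_addition_from_sine_addition[OF this] show thesis
      using that by blast
  qed
  have even': "\<mu> x * g (\<sigma> x) = g x" for x
    using fun_cong[OF even, of x] by (simp add: star_def)
  \<comment> \<open>In the equation expanded by the addition law for \<open>g\<close>, the terms in
    \<open>g\<close> cancel because \<open>g\<close> is even.\<close>
  have "t x * (t y + st t y) = 0" for x y
  proof -
    have "g x * g y + t x * t y + \<mu> y * g (\<sigma> y) * g x + \<mu> y * t (\<sigma> y) * t x = 2 * g y * g x"
      using eq[of x y] by (simp add: g algebra_simps)
    then show ?thesis by (simp add: even' star_def algebra_simps)
  qed
  then have odd: "st t y = - t y" for y
  proof (cases "t = (\<lambda>x. 0)")
    case True
    then show ?thesis by (simp add: star_def)
  next
    case False
    then obtain a where "t a \<noteq> 0" by auto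
    with \<open>\<And>x y. t x * (t y + st t y) = 0\<close>[of a y] show ?thesis
      by (simp add: add_eq_0_iff)
  qed
  show ?thesis
  proof (rule that[of "\<lambda>x. g x + t x"])
    show "multiplicative (\<lambda>x. g x + t x)"
      by (simp add: multiplicative_def g t algebra_simps)
    have "st (\<lambda>x. g x + t x) x = g x - t x" for x
      using even'[of x] odd[of x] by (simp add: star_def distrib_left)
    then show "g = (\<lambda>x. (g x + t x + st (\<lambda>x. g x + t x) x) / 2)"
      by simp
  qed
qed

section \<open>Reduction to \<open>f = g\<close>\<close>

lemma wilson_variant_solution_even:
  assumes gen: "generated_by_squares TYPE('a)"
    and eq: "\<And>x y. f (x * y) + \<mu> y * f (\<sigma> y * x) = 2 * f y * g x"
    and f0: "f \<noteq> (\<lambda>x. 0)"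
  shows "st f = f" and "st g = g" and "f x * g y = f y * g x"
proof -
  define u where "u = (\<lambda>x. f x - st f x)"
  define v where "v = (\<lambda>x. g x - st g x)"
  \<comment> \<open>This shares the term \<open>\<mu> y * f (\<sigma> y * x)\<close> with
    \<open>eq\<close>, so subtraction leaves the odd part of \<open>f\<close> at
    \<open>x * y\<close>.\<close>
  have st_eq: "\<mu> y * f (\<sigma> y * x) + st f (x * y) = 2 * f x * st g y" for x y
    using arg_cong[OF eq[of "\<sigma> y" x], of "\<lambda>c. \<mu> y * c"]
    by (simp add: star_def algebra_simps)
  have u1: "u (x * y) = 2 * f y * g x - 2 * f x * st g y" for x y
    using eq[of x y] st_eq[of y x] unfolding u_def by algebra
  \<comment> \<open>Apply \<open>st\<close> to the first formula for \<open>u (x * y)\<close>; the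
    left side changes sign since \<open>u\<close> is odd.\<close>
  have u2: "u (x * y) = 2 * st f x * g y - 2 * st f y * st g x" for x y
  proof -
    have "\<mu> x * \<mu> y * u (\<sigma> x * \<sigma> y) = - u (x * y)"
      by (simp add: u_def star_def right_diff_distrib ac_simps)
    moreover have "\<mu> y * st g (\<sigma> y) = g y"
      by (simp add: star_def)
    ultimately show ?thesis
      using u1[of "\<sigma> x" "\<sigma> y"] unfolding star_def by algebra
  qed
  have cross: "f y * g x - f x * st g y = st f x * g y - st f y * st g x" for x y
    using u1[of x y] u2[of x y] by algebra
  \<comment> \<open>Add \<open>cross\<close> to itself with \<open>x\<close> and \<open>y\<close>
    exchanged.\<close>
  have "u x * v y + u y * v x = 0" for x y
    using cross[of x y] cross[of y x] unfolding u_def v_def by algebra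
  then consider "\<forall>x. u x = 0" | "\<forall>x. v x = 0"
    using symmetrized_product_zero_cases[of u v] by blast
  then have "(\<forall>x. u x = 0) \<and> (\<forall>x. v x = 0)"
  proof cases
    case 1
    have "f x * v y + f y * v x = 0" for x y
      using u1[of x y] u1[of y x] 1[rule_format, of "x * y"] 1[rule_format, of "y * x"]
      unfolding v_def by algebra
    with f0 1 show ?thesis
      using symmetrized_product_zero_cases[of f v] by blast
  next
    case 2
    then have st_g: "st g x = g x" for x by (simp add: v_def)
    have "u (x * y) = u y * g x - u x * g y" for x y
      using u1[of x y] u2[of x y] st_g[of x] st_g[of y] unfolding u_def by algebra
    then have swap: "u (x * y) = - u (y * x)" for x y by simp
    have "u s = 0" for s
    proof -
      obtain x y z where s: "s = x * y * z"
        using generated_by_squares_product3[OF gen, of s] by blast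
      \<comment> \<open>Three cyclic shifts restore the product but change the sign an odd number of
        times.\<close>
      have "u (x * y * z) = - u (x * y * z)"
        using swap[of x "y * z"] swap[of y "z * x"] swap[of z "x * y"]
        by (simp add: mult.assoc)
      then show ?thesis by (simp add: s)
    qed
    with 2 show ?thesis by blast
  qed
  then have st_f': "st f x = f x" and st_g': "st g x = g x" for x
    by (simp_all add: u_def v_def)
  show "st f = f" and "st g = g" by (auto simp: st_f' st_g')
  show "f x * g y = f y * g x"
    using cross[of y x] by (simp add: st_f' st_g')
qed

text \<open>The three substitutions behind \<open>triple\<close> now have zero right-hand sides, so
  \<open>f\<close> vanishes on triple products. This rules out \<open>g = 0\<close> for nonzero
  \<open>f\<close>.\<close>

lemma wilson_variant_solution_zero:
  assumes gen: "generated_by_squares TYPE('a)"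
    and eq: "\<And>x y. f (x * y) + \<mu> y * f (\<sigma> y * x) = 0"
  shows "f = (\<lambda>x. 0)"
proof
  fix s :: 'a
  obtain x y z where s: "s = x * y * z"
    using generated_by_squares_product3[OF gen, of s] by blast
  have "f (x * y * z) + \<mu> z * f (\<sigma> z * x * y) = 0"
    using eq[of "x * y" z] by (simp add: mult.assoc)
  moreover have "f (\<sigma> z * x * y) + \<mu> y * f (\<sigma> y * \<sigma> z * x) = 0"
    using eq[of "\<sigma> z * x" y] by (simp add: mult.assoc)
  moreover have "f (x * y * z) + \<mu> y * \<mu> z * f (\<sigma> y * \<sigma> z * x) = 0"
    using eq[of x "y * z"] by (simp add: mult.assoc)
  ultimately have "2 * f (x * y * z) = 0" by algebra
  then show "f s = 0" by (simp add: s)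
qed

lemma wilson_variant_solution:
  assumes gen: "generated_by_squares TYPE('a)"
    and eq: "\<And>x y. f (x * y) + \<mu> y * f (\<sigma> y * x) = 2 * f y * g x"
    and f0: "f \<noteq> (\<lambda>x. 0)"
  obtains \<alpha> \<chi> where "\<alpha> \<noteq> 0" and "multiplicative \<chi>"
    and "f = (\<lambda>x. \<alpha> * ((\<chi> x + st \<chi> x) / 2))" and "g = (\<lambda>x. (\<chi> x + st \<chi> x) / 2)"
proof -
  note even = wilson_variant_solution_even[OF gen eq f0]
  obtain a where a: "f a \<noteq> 0" using f0 by auto
  have "g a \<noteq> 0"
  proof
    assume "g a = 0"
    then have "g x = 0" for x using even(3)[of a x] a by simp
    then show False using wilson_variant_solution_zero[OF gen, of f] eq f0 by simp
  qed
  \<comment> \<open>By the proportionality \<open>f x * g y = f y * g x\<close>, this ratio is the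
    same at every point where \<open>g\<close> is nonzero.\<close>
  define \<alpha> where "\<alpha> = f a / g a"
  have \<alpha>: "\<alpha> \<noteq> 0" using a \<open>g a \<noteq> 0\<close> by (simp add: \<alpha>_def)
  have f: "f x = \<alpha> * g x" for x
    using even(3)[of x a] \<open>g a \<noteq> 0\<close> by (simp add: \<alpha>_def field_simps)
  have "\<alpha> * (g (x * y) + \<mu> y * g (\<sigma> y * x)) = \<alpha> * (2 * g y * g x)" for x y
    using eq[of x y] by (simp add: f algebra_simps)
  then have "g (x * y) + \<mu> y * g (\<sigma> y * x) = 2 * g y * g x" for x y
    using \<alpha> by simp
  then obtain \<chi> where "multiplicative \<chi>" and g: "g = (\<lambda>x. (\<chi> x + st \<chi> x) / 2)"
    using dalembert_variant_solution even(2) by blast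
  moreover have "f = (\<lambda>x. \<alpha> * ((\<chi> x + st \<chi> x) / 2))"
    using f fun_cong[OF g] by auto
  ultimately show ?thesis using that \<alpha> by blast
qed

end

theorem theorem5p1:
  fixes \<sigma> :: "'a::semigroup_mult \<Rightarrow> 'a"
    and \<mu> f g :: "'a \<Rightarrow> complex"
  assumes "generated_by_squares TYPE('a)"
    and "involutive_automorphism \<sigma>"
    and "multiplicative \<mu>"
    and "\<And>x. \<mu> (x * \<sigma> x) = 1"
  shows "(\<forall>x y. f (x * y) + \<mu> y * f (\<sigma> y * x) = 2 * f y * g x) \<longleftrightarrow>
    f = (\<lambda>x. 0) \<or>
    (\<exists>\<alpha> \<chi>. \<alpha> \<noteq> 0 \<and> multiplicative \<chi> \<and>
       f = (\<lambda>x. \<alpha> * ((\<chi> x + star \<mu> \<sigma> \<chi> x) / 2)) \<and>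
       g = (\<lambda>x. (\<chi> x + star \<mu> \<sigma> \<chi> x) / 2))"
    (is "?eq \<longleftrightarrow> ?zero \<or> ?mean")
proof -
  interpret twisted_involution \<sigma> \<mu>
    using assms(2-4) by unfold_locales
  show ?thesis
  proof
    assume ?eq
    then have eq: "\<And>x y. f (x * y) + \<mu> y * f (\<sigma> y * x) = 2 * f y * g x" by blast
    show "?zero \<or> ?mean"
      using wilson_variant_solution[OF assms(1) eq] by metis
  next
    assume "?zero \<or> ?mean"
    then show ?eq
    proof
      assume ?zero
      then show ?eq by simp
    next
      assume ?mean
      then obtain \<alpha> \<chi> where \<chi>: "multiplicative \<chi>"
        and f: "f = (\<lambda>x. \<alpha> * g x)" and g: "g = (\<lambda>x. (\<chi> x + st \<chi> x) / 2)"
        by blast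
      show ?eq
      proof (intro allI)
        fix x y
        have "g (x * y) + \<mu> y * g (\<sigma> y * x) = 2 * g y * g x"
          unfolding g by (rule mean_star_solves[OF \<chi>])
        \<comment> \<open>The equation is linear in \<open>f\<close>, so the case
          \<open>f = g\<close> may be scaled.\<close>
        from arg_cong[OF this, of "\<lambda>c. \<alpha> * c"]
        show "f (x * y) + \<mu> y * f (\<sigma> y * x) = 2 * f y * g x"
          by (simp add: f algebra_simps)
      qed
    qed
  qed
qed

end
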